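(* Consider the Markovian change-point model. Fix any $c>0$, $\zeta\in\mathbb R^\kappa$ and $\delta\in\{0,1\}$. The function that maps $\gamma\in\mathbb R_+=[0,\infty)$ to $(1+\gamma)J_c^*(\gamma,\zeta,\delta)\in\mathbb R$ is concave.
   Context: Setup. Fix $2\le K<\infty$, $[K]=\{1,\dots,K\}$, $\mathbb N=\{1,2,\dots\}$. There is a latent process $L_t\in\{0,1\}$, $t\ge0$, with $L_t=0$ for $t<\Theta$ and $L_t=1$ for $t\ge\Theta$ ($\Theta=\Theta_{\mathcal X}$ is the change-point). At each $t\in\mathbb N$ a treatment $X_t\in[K]$ is selected and a response $Y_t$ in a Polish space $\mathbb Y$ is observed; $\mathcal F_t=\sigma(X_s,Y_s:1\le s\le t)$, $\mathcal F_0$ trivial. An assignment rule $\mathcal X=\{X_t\}$ has $X_1$ deterministic and $X_t$ a measurable function of $X_1,\dots,X_{t-1},Y_1,\dots,Y_{t-1}$. Response model: for each $x\in[K]$, $f_x,g_x$ are densities with respect to a $\sigma$-finite measure $\mu$ on $\mathbb Y$; given $X_t=x,L_t=i,\mathcal F_{t-1},L_0,\dots,L_{t-1}$, $Y_t$ has density $f_x$ if $i=0$, $g_x$ if $i=1$. Change-point model: $\mathsf P(L_0=1)=\pi_0\in[0,1)$, $\mathsf P(L_t=1\mid L_{t-1}=0,\mathcal F_{t-1},X_t)=\Pi_t$. Markovian model: $\Pi_t=\Psi(X_t,\mathbb S_{t-1})$, $\mathbb S_t=\Phi(X_t,\mathbb S_{t-1})$ for $t\in\mathbb N$, with $\mathbb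 S_0\in\mathbb R^\kappa$ deterministic, $\kappa\ge0$, $\Psi:[K]\times\mathbb R^\kappa\to[0,1)$, $\Phi:[K]\times\mathbb R^\kappa\to\mathbb R^\kappa$. Posterior odds $\Gamma_t=\mathsf P(L_t=1\mid\mathcal F_t)/\mathsf P(L_t=0\mid\mathcal F_t)$, $\Gamma_0=\pi_0/(1-\pi_0)$. $\mathcal C$ is the class of pairs $(\mathcal X,T)$ with $\mathcal X$ an assignment rule and $T$ an $\{\mathcal F_t\}$-stopping time. $\mathsf P_{\gamma,\zeta},\mathsf E_{\gamma,\zeta}$ denote probability and expectation when $\Gamma_0=\gamma$ (i.e. $\pi_0=\gamma/(1+\gamma)$) and $\mathbb S_0=\zeta$. The optimal cost function is $J_c^*(\gamma,\zeta,0)=\inf_{(\mathcal X,T)\in\mathcal C}\{c\,\mathsf E_{\gamma,\zeta}[T]+\mathsf P_{\gamma,\zeta}(T<\Theta_{\mathcal X})\}$ (process not yet terminated) and $J_c^*(\gamma,\zeta,1)=0$ (process already terminated). *)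

theory Defs
  imports "HOL-Probability.Probability"
begin

section \<open>Sample paths\<close>

text \<open>
  A sample path is a sequence \<open>\<omega>\<close> whose \<open>t\<close>-th coordinate is the pair \<open>(L\<^sub>t, Y\<^sub>t)\<close>; \<open>True\<close> encodes
  \<open>L\<^sub>t = 1\<close>. Responses exist only for \<open>t \<ge> 1\<close>, so \<open>snd (\<omega> 0)\<close> is a dummy that nothing below reads.
\<close>

type_synonym 'y path = "nat \<Rightarrow> bool \<times> 'y"

definition latent :: "nat \<Rightarrow> 'y path \<Rightarrow> bool" where
  "latent t \<omega> = fst (\<omega> t)"

definition response :: "nat \<Rightarrow> 'y path \<Rightarrow> 'y" where
  "response t \<omega> = snd (\<omega> t)"

definition change_point :: "'y path \<Rightarrow> enat" where
  "change_point \<omega> = Inf {enat t |t. latent t \<omega>}"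

definition obs_space :: "(bool \<times> 'y::polish_space) measure" where
  "obs_space = count_space UNIV \<Otimes>\<^sub>M borel"


section \<open>Assignment rules and stopping times\<close>

text \<open>
  The decision at time \<open>t\<close> is a function of the history \<open>s \<mapsto> (X\<^sub>s, Y\<^sub>s)\<close>, \<open>1 \<le> s < t\<close>. For \<open>t = 1\<close> the
  history space is a singleton, so the first treatment is deterministic.
\<close>

type_synonym 'y rule = "nat \<Rightarrow> (nat \<Rightarrow> nat \<times> 'y) \<Rightarrow> nat"

definition assignment_rules :: "nat \<Rightarrow> 'y::polish_space rule set" where
  "assignment_rules K = {\<rho>. \<forall>t\<ge>1. \<rho> t \<in>
     (\<Pi>\<^sub>M s\<in>{1..<t}. count_space {1..K} \<Otimes>\<^sub>M borel) \<rightarrow>\<^sub>M count_space {1..K}}"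

lemma restrict_fundef_cong [fundef_cong]:
  "A = B \<Longrightarrow> (\<And>x. x \<in> B \<Longrightarrow> f x = g x) \<Longrightarrow> restrict f A = restrict g B"
  by (auto simp: restrict_def fun_eq_iff)

function treatment :: "'y rule \<Rightarrow> nat \<Rightarrow> 'y path \<Rightarrow> nat" where
  "treatment \<rho> t \<omega> = \<rho> t (\<lambda>s\<in>{1..<t}. (treatment \<rho> s \<omega>, response s \<omega>))"
  by pat_completeness auto
termination
  by (relation "Wellfounded.measure (\<lambda>(\<rho>, t, \<omega>). t)") auto

declare treatment.simps [simp del]

text \<open>
  Time ranges over \<^typ>\<open>enat\<close> so that stopping times may take the value \<open>\<infinity>\<close>; the stopping condition
  at \<open>t = \<infinity>\<close> is void.
\<close>

definition observed :: "'y::polish_space rule \<Rightarrow> enat \<Rightarrow> 'y path measure" where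
  "observed \<rho> t = sigma UNIV (\<Union>s\<in>{s. 1 \<le> s \<and> enat s \<le> t}.
     {treatment \<rho> s -` A |A. A \<in> UNIV} \<union> {response s -` B |B. B \<in> sets borel})"

definition policies :: "nat \<Rightarrow> ('y::polish_space rule \<times> ('y path \<Rightarrow> enat)) set" where
  "policies K = {(\<rho>, T). \<rho> \<in> assignment_rules K \<and> stopping_time (observed \<rho>) T}"


section \<open>The Markovian change-point model\<close>

text \<open>
  \<open>\<real>\<^sup>\<kappa>\<close> is modelled by extensional functions on \<open>{..<\<kappa>}\<close>, which includes \<open>\<kappa> = 0\<close>.
\<close>

definition Rn :: "nat \<Rightarrow> (nat \<Rightarrow> real) set" where
  "Rn \<kappa> = ({..<\<kappa>} \<rightarrow>\<^sub>E UNIV)"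

locale markov_changepoint =
  fixes K :: nat
    and \<mu> :: "'y::polish_space measure"
    and f g :: "nat \<Rightarrow> 'y \<Rightarrow> real"
    and \<kappa> :: nat
    and \<Psi> :: "nat \<Rightarrow> (nat \<Rightarrow> real) \<Rightarrow> real"
    and \<Phi> :: "nat \<Rightarrow> (nat \<Rightarrow> real) \<Rightarrow> (nat \<Rightarrow> real)"
  assumes K: "2 \<le> K"
    and sets_\<mu>: "sets \<mu> = sets borel"
    and sigma_finite_\<mu>: "sigma_finite_measure \<mu>"
    and f_measurable: "\<And>x. x \<in> {1..K} \<Longrightarrow> f x \<in> borel_measurable borel"
    and f_nonneg: "\<And>x y. x \<in> {1..K} \<Longrightarrow> 0 \<le> f x y"
    and f_density: "\<And>x. x \<in> {1..K} \<Longrightarrow> (\<integral>\<^sup>+ y. ennreal (f x y) \<partial>\<mu>) = 1"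
    and g_measurable: "\<And>x. x \<in> {1..K} \<Longrightarrow> g x \<in> borel_measurable borel"
    and g_nonneg: "\<And>x y. x \<in> {1..K} \<Longrightarrow> 0 \<le> g x y"
    and g_density: "\<And>x. x \<in> {1..K} \<Longrightarrow> (\<integral>\<^sup>+ y. ennreal (g x y) \<partial>\<mu>) = 1"
    and \<Psi>_range: "\<And>x s. x \<in> {1..K} \<Longrightarrow> s \<in> Rn \<kappa> \<Longrightarrow> \<Psi> x s \<in> {0..<1}"
    and \<Phi>_range: "\<And>x s. x \<in> {1..K} \<Longrightarrow> s \<in> Rn \<kappa> \<Longrightarrow> \<Phi> x s \<in> Rn \<kappa>"
begin

primrec state :: "(nat \<Rightarrow> real) \<Rightarrow> 'y rule \<Rightarrow> nat \<Rightarrow> 'y path \<Rightarrow> (nat \<Rightarrow> real)" where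
  "state \<zeta> \<rho> 0 \<omega> = \<zeta>"
| "state \<zeta> \<rho> (Suc t) \<omega> = \<Phi> (treatment \<rho> (Suc t) \<omega>) (state \<zeta> \<rho> t \<omega>)"

definition transition_prob :: "(nat \<Rightarrow> real) \<Rightarrow> 'y rule \<Rightarrow> nat \<Rightarrow> 'y path \<Rightarrow> real" where
  "transition_prob \<zeta> \<rho> t \<omega> = \<Psi> (treatment \<rho> t \<omega>) (state \<zeta> \<rho> (t - 1) \<omega>)"

definition response_law :: "nat \<Rightarrow> bool \<Rightarrow> 'y measure" where
  "response_law x l = density \<mu> (\<lambda>y. ennreal (if l then g x y else f x y))"

text \<open>
  The conditional law of \<open>(L\<^sub>t, Y\<^sub>t)\<close> given \<open>h = ((L\<^sub>s, Y\<^sub>s))\<^sub>s\<^sub><\<^sub>t\<close>. The quantities \<open>X\<^sub>t\<close> and \<open>\<Pi>\<^sub>t\<close> depend only on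
  \<open>Y\<^sub>1, \<dots>, Y\<^sub>t\<^sub>-\<^sub>1\<close>, hence are determined by \<open>h\<close>. The initial odds \<open>\<gamma>\<close> correspond to
  \<open>\<pi>\<^sub>0 = \<gamma> / (1 + \<gamma>)\<close>.
\<close>

definition path_kernel :: "real \<Rightarrow> (nat \<Rightarrow> real) \<Rightarrow> 'y rule \<Rightarrow> nat \<Rightarrow> 'y path \<Rightarrow> (bool \<times> 'y) measure" where
  "path_kernel \<gamma> \<zeta> \<rho> t h =
     (if t = 0 then
        measure_pmf (bernoulli_pmf (\<gamma> / (1 + \<gamma>))) \<bind> (\<lambda>l. return obs_space (l, undefined))
      else
        measure_pmf (bernoulli_pmf (if latent (t - 1) h then 1 else transition_prob \<zeta> \<rho> t h)) \<bind>
          (\<lambda>l. distr (response_law (treatment \<rho> t h) l) obs_space (Pair l)))"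

text \<open>\<open>\<P>\<^sub>\<gamma>\<^sub>,\<^sub>\<zeta>\<close> under the rule \<open>\<rho>\<close>: the Ionescu-Tulcea measure of these kernels.\<close>

definition path_law :: "real \<Rightarrow> (nat \<Rightarrow> real) \<Rightarrow> 'y rule \<Rightarrow> 'y path measure" where
  "path_law \<gamma> \<zeta> \<rho> = projective_family.lim UNIV
     (Ionescu_Tulcea.CI (path_kernel \<gamma> \<zeta> \<rho>) (\<lambda>_. obs_space)) (\<lambda>_. obs_space)"

text \<open>
  The kernels satisfy the hypotheses of the Ionescu-Tulcea theorem for every assignment rule, so
  \<open>path_law\<close> is the probability measure under which each \<open>(L\<^sub>t, Y\<^sub>t)\<close> has the prescribed conditional law.
\<close>

lemma treatment_measurable:
  assumes "\<rho> \<in> assignment_rules K" "1 \<le> t" "{1..<t} \<subseteq> I"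
  shows "treatment \<rho> t \<in> (\<Pi>\<^sub>M s\<in>I. obs_space) \<rightarrow>\<^sub>M count_space {1..K}"
  using assms(2,3)
proof (induction t rule: less_induct)
  case (less t)
  have "(\<lambda>\<omega>. \<lambda>s\<in>{1..<t}. (treatment \<rho> s \<omega>, response s \<omega>))
      \<in> (\<Pi>\<^sub>M s\<in>I. obs_space) \<rightarrow>\<^sub>M (\<Pi>\<^sub>M s\<in>{1..<t}. count_space {1..K} \<Otimes>\<^sub>M borel)"
  proof (intro measurable_restrict measurable_Pair)
    fix s assume s: "s \<in> {1..<t}"
    then have "{1..<s} \<subseteq> I" and [simp]: "s \<in> I"
      using less.prems by auto
    then show "treatment \<rho> s \<in> (\<Pi>\<^sub>M s\<in>I. obs_space) \<rightarrow>\<^sub>M count_space {1..K}"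
      using less.IH[of s] s by auto
    have "(\<lambda>\<omega>. \<omega> s) \<in> (\<Pi>\<^sub>M s\<in>I. obs_space) \<rightarrow>\<^sub>M (count_space UNIV \<Otimes>\<^sub>M borel)"
      using measurable_component_singleton[of s I "\<lambda>_. obs_space"] by (simp add: obs_space_def)
    then show "response s \<in> (\<Pi>\<^sub>M s\<in>I. obs_space) \<rightarrow>\<^sub>M borel"
      unfolding response_def by measurable
  qed
  from measurable_compose[OF this] assms(1) less.prems(1) show ?case
    unfolding treatment.simps[of \<rho> t, abs_def] assignment_rules_def by blast
qed

lemma state_measurable:
  assumes \<rho>: "\<rho> \<in> assignment_rules K" and "{1..<Suc t} \<subseteq> I"
  shows "\<exists>A. countable A \<and> state \<zeta> \<rho> t \<in> (\<Pi>\<^sub>M s\<in>I. obs_space) \<rightarrow>\<^sub>M count_space A"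
  using assms(2)
proof (induction t)
  case 0
  have "state \<zeta> \<rho> 0 = (\<lambda>_. \<zeta>)"
    by (rule ext) simp
  then show ?case
    by (intro exI[of _ "{\<zeta>}"]) simp
next
  case (Suc t)
  then obtain A where A: "countable A"
      "state \<zeta> \<rho> t \<in> (\<Pi>\<^sub>M s\<in>I. obs_space) \<rightarrow>\<^sub>M count_space A"
    by fastforce
  let ?B = "(\<lambda>(x, s). \<Phi> x s) ` ({1..K} \<times> A)"
  have "(\<lambda>\<omega>. (treatment \<rho> (Suc t) \<omega>, state \<zeta> \<rho> t \<omega>))
      \<in> (\<Pi>\<^sub>M s\<in>I. obs_space) \<rightarrow>\<^sub>M (count_space {1..K} \<Otimes>\<^sub>M count_space A)"
    using Suc.prems A by (intro measurable_Pair treatment_measurable \<rho>) auto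
  also have "count_space {1..K} \<Otimes>\<^sub>M count_space A = count_space ({1..K} \<times> A)"
    using A by (intro pair_measure_countable) auto
  finally have "(\<lambda>\<omega>. (\<lambda>(x, s). \<Phi> x s) (treatment \<rho> (Suc t) \<omega>, state \<zeta> \<rho> t \<omega>))
      \<in> (\<Pi>\<^sub>M s\<in>I. obs_space) \<rightarrow>\<^sub>M count_space ?B"
    by (rule measurable_compose) auto
  with A show ?case
    by (intro exI[of _ ?B]) auto
qed

lemma response_law_prob:
  assumes "x \<in> {1..K}"
  shows "prob_space (response_law x l)" "sets (response_law x l) = sets borel"
proof -
  have "(\<lambda>y. ennreal (if l then g x y else f x y)) \<in> borel_measurable \<mu>"
    using f_measurable[OF assms] g_measurable[OF assms]
    by (cases l) (simp_all add: measurable_cong_sets[OF sets_\<mu> refl])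
  then show "prob_space (response_law x l)"
    using f_density[OF assms] g_density[OF assms]
    by (intro prob_spaceI) (cases l; simp add: response_law_def emeasure_density cong: nn_integral_cong)
  show "sets (response_law x l) = sets borel"
    by (simp add: response_law_def sets_\<mu>)
qed

lemma Ionescu_Tulcea_path_kernel:
  assumes \<rho>: "\<rho> \<in> assignment_rules K"
  shows "Ionescu_Tulcea (path_kernel \<gamma> \<zeta> \<rho>) (\<lambda>_. obs_space)"
proof -
  define step where "step p x = measure_pmf (bernoulli_pmf p) \<bind>
      (\<lambda>l. distr (response_law x l) obs_space (Pair l))" for p x
  have Pair: "Pair l \<in> response_law x l \<rightarrow>\<^sub>M obs_space" if "x \<in> {1..K}" for l x
    unfolding obs_space_def measurable_cong_sets[OF response_law_prob(2)[OF that] refl]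
    by (intro measurable_Pair1') simp
  have space_obs: "space obs_space = (UNIV :: (bool \<times> 'y) set)"
    by (simp add: obs_space_def space_pair_measure)
  have inner: "distr (response_law x l) obs_space (Pair l) \<in> space (prob_algebra obs_space)"
    if "x \<in> {1..K}" for x l
    unfolding space_prob_algebra
    using prob_space.prob_space_distr[OF response_law_prob(1)[OF that] Pair[OF that]] by simp
  have coin: "measure_pmf p \<in> space (prob_algebra (count_space UNIV))" for p :: "bool pmf"
    unfolding space_prob_algebra using measure_pmf.prob_space_axioms by simp
  have bind_in: "measure_pmf p \<bind> N \<in> space (prob_algebra obs_space)"
    if "\<And>l. N l \<in> space (prob_algebra obs_space)" for p :: "bool pmf" and N :: "bool \<Rightarrow> (bool \<times> 'y) measure"
  proof -
    have "N \<in> count_space UNIV \<rightarrow>\<^sub>M prob_algebra obs_space"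
      using that by simp
    from measurable_bind_prob_space[OF measurable_const[OF coin] this, of p "count_space (UNIV :: unit set)"]
    show ?thesis by (auto simp: Pi_iff)
  qed
  have step_in: "step p x \<in> space (prob_algebra obs_space)" if "x \<in> {1..K}" for p x
    unfolding step_def by (intro bind_in inner that)
  have K: "path_kernel \<gamma> \<zeta> \<rho> t \<in> (\<Pi>\<^sub>M s\<in>{0..<t}. obs_space) \<rightarrow>\<^sub>M prob_algebra obs_space" for t
  proof (cases "t = 0")
    case True
    have "return obs_space (l, undefined :: 'y) \<in> space (prob_algebra obs_space)" for l
      unfolding space_prob_algebra by (simp add: space_obs prob_space_return)
    then show ?thesis
      using True unfolding path_kernel_def[abs_def] by (simp add: bind_in)
  next
    case False
    have "{1..<Suc (t - 1)} \<subseteq> {0..<t}" "{1..<t} \<subseteq> {0..<t}"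
      using False by auto
    then obtain A where A: "countable A"
        "state \<zeta> \<rho> (t - 1) \<in> (\<Pi>\<^sub>M s\<in>{0..<t}. obs_space) \<rightarrow>\<^sub>M count_space A"
      and X: "treatment \<rho> t \<in> (\<Pi>\<^sub>M s\<in>{0..<t}. obs_space) \<rightarrow>\<^sub>M count_space {1..K}"
      using state_measurable[OF \<rho>] treatment_measurable[OF \<rho>, of t] False
      by (metis One_nat_def Suc_leI bot_nat_0.not_eq_extremum)
    have "(\<lambda>\<omega>. \<omega> (t - 1)) \<in> (\<Pi>\<^sub>M s\<in>{0..<t}. obs_space) \<rightarrow>\<^sub>M (count_space UNIV \<Otimes>\<^sub>M borel)"
      using measurable_component_singleton[of "t - 1" "{0..<t}" "\<lambda>_. obs_space"] False
      by (simp add: obs_space_def)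
    then have L: "latent (t - 1) \<in> (\<Pi>\<^sub>M s\<in>{0..<t}. obs_space) \<rightarrow>\<^sub>M count_space UNIV"
      unfolding latent_def by measurable
    let ?S = "\<lambda>(l, x, s). step (if l then 1 else \<Psi> x s) x"
    have "?S \<in> count_space ((UNIV :: bool set) \<times> {1..K} \<times> A) \<rightarrow>\<^sub>M prob_algebra obs_space"
      using step_in by auto
    also have "count_space ((UNIV :: bool set) \<times> {1..K} \<times> A)
        = count_space (UNIV :: bool set) \<Otimes>\<^sub>M (count_space {1..K} \<Otimes>\<^sub>M count_space A)"
      using A(1) by (subst pair_measure_countable; simp)+
    finally have "(\<lambda>h. ?S (latent (t - 1) h, treatment \<rho> t h, state \<zeta> \<rho> (t - 1) h))
        \<in> (\<Pi>\<^sub>M s\<in>{0..<t}. obs_space) \<rightarrow>\<^sub>M prob_algebra obs_space"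
      by (rule measurable_compose[rotated]) (intro measurable_Pair L X A)
    then show ?thesis
      using False by (simp add: path_kernel_def[abs_def] step_def transition_prob_def cong: if_cong)
  qed
  show ?thesis
    using K[THEN measurable_prob_algebraD] measurable_space[OF K]
    by (intro Ionescu_Tulcea.intro) (auto simp: space_prob_algebra)
qed

definition cost :: "real \<Rightarrow> real \<Rightarrow> (nat \<Rightarrow> real) \<Rightarrow> 'y rule \<Rightarrow> ('y path \<Rightarrow> enat) \<Rightarrow> ennreal" where
  "cost c \<gamma> \<zeta> \<rho> T =
     ennreal c * (\<integral>\<^sup>+ \<omega>. ennreal_of_enat (T \<omega>) \<partial>path_law \<gamma> \<zeta> \<rho>)
     + emeasure (path_law \<gamma> \<zeta> \<rho>) {\<omega> \<in> space (path_law \<gamma> \<zeta> \<rho>). T \<omega> < change_point \<omega>}"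

text \<open>
  The flag \<open>\<delta>\<close> is \<open>1\<close> if the process has already been terminated. Stopping at time \<open>0\<close> costs at most
  \<open>1\<close>, so the infimum is finite and the conversion to a real number loses nothing.
\<close>

definition optimal_cost :: "real \<Rightarrow> real \<Rightarrow> (nat \<Rightarrow> real) \<Rightarrow> nat \<Rightarrow> real" where
  "optimal_cost c \<gamma> \<zeta> \<delta> =
     (if \<delta> = 0 then enn2real (INF (\<rho>, T)\<in>policies K. cost c \<gamma> \<zeta> \<rho> T) else 0)"

end

end

theory Submission
  imports Defs
begin

text \<open>
  For a fixed policy, \<open>(1 + \<gamma>)\<close> times the path law is affine in \<open>\<gamma>\<close>, because only the law of \<open>L\<^sub>0\<close>
  depends on \<open>\<gamma>\<close>, and \<open>(1 + \<gamma>)\<close> times that law has the weights \<open>\<gamma>\<close> and \<open>1\<close>. Hence \<open>(1 + \<gamma>)\<close> times the cost of the policy is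
  affine in \<open>\<gamma>\<close>, and the optimal cost is an infimum of such functions.
\<close>

section \<open>Mixtures of probability measures and their integrals\<close>

text \<open>A Dynkin argument: the sets satisfying the mixture identity are closed under
  complements, because all three measures have total mass 1 and \<open>p + q = 1\<close>, and under
  countable disjoint unions.\<close>

lemma emeasure_mixture_sigma_sets:
  fixes p q :: real
  assumes prob: "prob_space N" "prob_space N1" "prob_space N2"
    and pq: "0 \<le> p" "0 \<le> q" "p + q = 1"
    and G: "Int_stable G" "G \<subseteq> Pow \<Omega>"
    and sets: "sets N = sigma_sets \<Omega> G" "sets N1 = sigma_sets \<Omega> G" "sets N2 = sigma_sets \<Omega> G"
    and eq: "\<And>A. A \<in> G \<Longrightarrow> emeasure N A = ennreal p * emeasure N1 A + ennreal q * emeasure N2 A"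
    and A: "A \<in> sets N"
  shows "emeasure N A = ennreal p * emeasure N1 A + ennreal q * emeasure N2 A"
proof -
  interpret N: prob_space N by fact
  interpret N1: prob_space N1 by fact
  interpret N2: prob_space N2 by fact
  have space: "space N = \<Omega>" "space N1 = \<Omega>" "space N2 = \<Omega>"
    using sets[THEN sets_eq_imp_space_eq[OF trans[OF _ sets_measure_of[OF G(2), symmetric]]]]
      space_measure_of[OF G(2)] by simp_all
  \<comment> \<open>The identity is moved to the reals, where the complement case can subtract
    freely; all three measures are finite and the weights nonnegative.\<close>
  have iff: "emeasure N B = ennreal p * emeasure N1 B + ennreal q * emeasure N2 B
      \<longleftrightarrow> measure N B = p * measure N1 B + q * measure N2 B" for B
    using pq by (simp add: N.emeasure_eq_measure N1.emeasure_eq_measure N2.emeasure_eq_measure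
        flip: ennreal_mult ennreal_plus)
  have "A \<in> sigma_sets \<Omega> G"
    using A sets by simp
  with G have "measure N A = p * measure N1 A + q * measure N2 A"
  proof (induction rule: sigma_sets_induct_disjoint)
    case (basic B)
    with eq iff show ?case by simp
  next
    case empty
    show ?case by simp
  next
    case (compl B)
    have "measure N (\<Omega> - B) = 1 - measure N B" "measure N1 (\<Omega> - B) = 1 - measure N1 B"
        "measure N2 (\<Omega> - B) = 1 - measure N2 B"
      using N.prob_compl[of B] N1.prob_compl[of B] N2.prob_compl[of B] compl(1) sets space by auto
    moreover have "q = 1 - p"
      using pq(3) by simp
    ultimately show ?case
      using compl(2) by (simp only:) (simp add: algebra_simps)
  next
    case (union B)
    have "range B \<subseteq> sets N" "range B \<subseteq> sets N1" "range B \<subseteq> sets N2"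
      using union(2) sets by auto
    then have "(\<lambda>i. measure N (B i)) sums measure N (\<Union>i. B i)"
        "(\<lambda>i. p * measure N1 (B i) + q * measure N2 (B i))
          sums (p * measure N1 (\<Union>i. B i) + q * measure N2 (\<Union>i. B i))"
      using union(1)
      by (auto intro!: sums_add sums_mult N.finite_measure_UNION N1.finite_measure_UNION
          N2.finite_measure_UNION)
    then show ?case
      using union(3) sums_unique2 by simp
  qed
  with iff show ?thesis by simp
qed

text \<open>The integral is linear in the measure: \<open>eq\<close> is the case of indicators, and
  scaling, sums and monotone limits carry it to all nonnegative Borel functions.\<close>

lemma nn_integral_mixture:
  assumes sets: "sets N1 = sets N" "sets N2 = sets N"
    and eq: "\<And>A. A \<in> sets N \<Longrightarrow> emeasure N A = p * emeasure N1 A + q * emeasure N2 A"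
    and h: "h \<in> borel_measurable N"
  shows "(\<integral>\<^sup>+ x. h x \<partial>N) = p * (\<integral>\<^sup>+ x. h x \<partial>N1) + q * (\<integral>\<^sup>+ x. h x \<partial>N2)"
  using h
proof induction
  case (cong h h')
  have "integral\<^sup>N M h = integral\<^sup>N M h'" if "sets M = sets N" for M
    using cong(3) sets_eq_imp_space_eq[OF that] by (intro nn_integral_cong) auto
  from this[OF refl] this[OF sets(1)] this[OF sets(2)] cong(4) show ?case by simp
next
  case (set A)
  with eq sets show ?case by simp
next
  case (mult u c)
  from mult show ?case
    by (simp add: nn_integral_cmult measurable_cong_sets[OF sets(1) refl]
        measurable_cong_sets[OF sets(2) refl]) (simp add: algebra_simps)
next
  case (add u v)
  then show ?case
    by (simp add: nn_integral_add measurable_cong_sets[OF sets(1) refl]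
        measurable_cong_sets[OF sets(2) refl]) (simp add: algebra_simps)
next
  case (seq U)
  \<comment> \<open>A sum of two suprema is the supremum of the termwise sums only along monotone
    sequences, so both scaled sequences must be increasing.\<close>
  have inc: "incseq (\<lambda>i. c * integral\<^sup>N M (U i))" for c and M :: "'a measure"
    using seq(3) by (auto simp: incseq_def le_fun_def intro!: mult_left_mono nn_integral_mono)
  have SUP: "integral\<^sup>N M (SUP i. U i) = (SUP i. integral\<^sup>N M (U i))" if "sets M = sets N" for M
    unfolding SUP_apply[abs_def] using seq(1,3)
    by (intro nn_integral_monotone_convergence_SUP) (simp_all add: measurable_cong_sets[OF that refl])
  show ?case
    unfolding SUP[OF refl] SUP[OF sets(1)] SUP[OF sets(2)] seq.IH SUP_mult_left_ennreal
    by (intro ennreal_SUP_add inc)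
qed

section \<open>Ionescu-Tulcea measures with mixed initial laws\<close>

text \<open>The whole space is the cylinder over the empty index set, so its mass is that of the
  probability measure \<open>CI {}\<close>.\<close>

lemma prob_space_Ionescu_Tulcea_lim:
  assumes "Ionescu_Tulcea P M"
  shows "prob_space (projective_family.lim UNIV (Ionescu_Tulcea.CI P M) M)"
proof (rule prob_spaceI)
  interpret Ionescu_Tulcea P M by fact
  have "emeasure PF.lim (PF.emb UNIV {} (space (PiM {} M))) = emeasure (CI {}) (space (PiM {} M))"
    by (rule lim) auto
  also have "\<dots> = 1"
    using prob_space.emeasure_space_1[OF PF.prob_space_P, of "{}"] by (simp add: PF.space_P)
  finally show "emeasure PF.lim (space PF.lim) = 1"
    by (simp add: prod_emb_def space_PiM vimage_def restrict_def)
qed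

text \<open>Induction on the horizon \<open>m\<close>. The mixture enters with coordinate 0; from
  then on the three processes share their kernels, so each extension integrates one common function
  and preserves the mixture.\<close>

lemma emeasure_Ionescu_Tulcea_C_mixture:
  fixes p q :: real
  assumes IT: "Ionescu_Tulcea P M" "Ionescu_Tulcea P1 M" "Ionescu_Tulcea P2 M"
    and pq: "0 \<le> p" "0 \<le> q" "p + q = 1"
    and initial: "\<And>A. A \<in> sets (M 0) \<Longrightarrow> emeasure (P 0 (\<lambda>_. undefined)) A
      = ennreal p * emeasure (P1 0 (\<lambda>_. undefined)) A + ennreal q * emeasure (P2 0 (\<lambda>_. undefined)) A"
    and later: "\<And>n. n > 0 \<Longrightarrow> P1 n = P n" "\<And>n. n > 0 \<Longrightarrow> P2 n = P n"
    and A: "A \<in> sets (PiM {0..<m} M)"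
  shows "emeasure (Ionescu_Tulcea.C P M 0 m (\<lambda>_. undefined)) A
    = ennreal p * emeasure (Ionescu_Tulcea.C P1 M 0 m (\<lambda>_. undefined)) A
      + ennreal q * emeasure (Ionescu_Tulcea.C P2 M 0 m (\<lambda>_. undefined)) A"
proof -
  interpret I: Ionescu_Tulcea P M by fact
  interpret I1: Ionescu_Tulcea P1 M by fact
  interpret I2: Ionescu_Tulcea P2 M by fact
  have [simp]: "(\<lambda>_. undefined) \<in> space (PiM {0..<0} M)"
    by (simp add: space_PiM)
  have step: "emeasure (Ionescu_Tulcea.C Q M 0 (Suc m) (\<lambda>_. undefined)) A
      = (\<integral>\<^sup>+ x. emeasure (Ionescu_Tulcea.eP Q M m x) A \<partial>Ionescu_Tulcea.C Q M 0 m (\<lambda>_. undefined))"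
    if "Ionescu_Tulcea Q M" "A \<in> sets (PiM {0..<Suc m} M)" for Q m A
  proof -
    interpret Q: Ionescu_Tulcea Q M by fact
    show ?thesis
      using that(2) Q.measurable_eP[of m] Q.prob_space_C[of "\<lambda>_. undefined" 0 m]
      by (simp add: emeasure_bind[where N="PiM {0..<Suc m} M"] prob_space.not_empty
          measurable_cong_sets[OF Q.sets_C refl])
  qed
  show ?thesis
    using A
  proof (induction m arbitrary: A)
    case 0
    \<comment> \<open>Before any coordinate is drawn, all three laws are the same point mass, so the
      claim reduces to \<open>p + q = 1\<close>.\<close>
    then show ?case
      using pq by (simp flip: distrib_right ennreal_plus)
  next
    case (Suc m)
    show ?case
    proof (cases "m = 0")
      case True
      \<comment> \<open>The law of the first coordinate is the image of the initial kernel under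
        \<open>fun_upd\<close>, so \<open>initial\<close> applies to the preimage of
        \<open>A\<close>.\<close>
      have upd: "fun_upd (\<lambda>_. undefined) 0 \<in> M 0 \<rightarrow>\<^sub>M PiM {0..<Suc 0} M"
        by (rule measurable_fun_upd[where J="{}"]) auto
      have "emeasure (Ionescu_Tulcea.C Q M 0 (Suc 0) (\<lambda>_. undefined)) A
          = emeasure (Q 0 (\<lambda>_. undefined)) (fun_upd (\<lambda>_. undefined) 0 -` A \<inter> space (M 0))"
        if "Ionescu_Tulcea Q M" for Q
      proof -
        interpret Q: Ionescu_Tulcea Q M by fact
        show ?thesis
          using Suc.prems True Q.measurable_eP[of 0]
          by (simp add: bind_return[where N="PiM {0..<Suc 0} M"] Q.emeasure_eP)
      qed
      from this[OF IT(1)] this[OF IT(2)] this[OF IT(3)] initial[OF measurable_sets[OF upd]] Suc.prems True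
      show ?thesis
        by (simp del: I.C.simps I1.C.simps I2.C.simps)
    next
      case False
      have eP: "I1.eP m = I.eP m" "I2.eP m = I.eP m"
        using False later by (simp_all add: fun_eq_iff I.eP_def I1.eP_def I2.eP_def)
      have "(\<lambda>x. emeasure (I.eP m x) A) \<in> borel_measurable (PiM {0..<m} M)"
        using measurable_emeasure_kernel[OF I.measurable_eP Suc.prems] .
      then have "(\<integral>\<^sup>+ x. emeasure (I.eP m x) A \<partial>I.C 0 m (\<lambda>_. undefined))
          = ennreal p * (\<integral>\<^sup>+ x. emeasure (I.eP m x) A \<partial>I1.C 0 m (\<lambda>_. undefined))
            + ennreal q * (\<integral>\<^sup>+ x. emeasure (I.eP m x) A \<partial>I2.C 0 m (\<lambda>_. undefined))"
        by (intro nn_integral_mixture Suc.IH)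
          (simp_all add: I.sets_C I1.sets_C I2.sets_C measurable_cong_sets[OF I.sets_C refl])
      then show ?thesis
        unfolding step[OF IT(1) Suc.prems] step[OF IT(2) Suc.prems] step[OF IT(3) Suc.prems] eP .
    qed
  qed
qed

text \<open>Cylinders form an algebra, hence an intersection-stable generator; on each of them the
  limit is determined by finitely many coordinates, where the finite-horizon mixture is
  known.\<close>

lemma emeasure_Ionescu_Tulcea_lim_mixture:
  fixes p q :: real
  assumes IT: "Ionescu_Tulcea P M" "Ionescu_Tulcea P1 M" "Ionescu_Tulcea P2 M"
    and pq: "0 \<le> p" "0 \<le> q" "p + q = 1"
    and initial: "\<And>A. A \<in> sets (M 0) \<Longrightarrow> emeasure (P 0 (\<lambda>_. undefined)) A
      = ennreal p * emeasure (P1 0 (\<lambda>_. undefined)) A + ennreal q * emeasure (P2 0 (\<lambda>_. undefined)) A"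
    and later: "\<And>n. n > 0 \<Longrightarrow> P1 n = P n" "\<And>n. n > 0 \<Longrightarrow> P2 n = P n"
    and A: "A \<in> sets (PiM UNIV M)"
  shows "emeasure (projective_family.lim UNIV (Ionescu_Tulcea.CI P M) M) A
    = ennreal p * emeasure (projective_family.lim UNIV (Ionescu_Tulcea.CI P1 M) M) A
      + ennreal q * emeasure (projective_family.lim UNIV (Ionescu_Tulcea.CI P2 M) M) A"
proof -
  interpret I: Ionescu_Tulcea P M by fact
  interpret I1: Ionescu_Tulcea P1 M by fact
  interpret I2: Ionescu_Tulcea P2 M by fact
  note prob = prob_space_Ionescu_Tulcea_lim
  have G: "Int_stable I.PF.generator" "I.PF.generator \<subseteq> Pow (space (PiM UNIV M))"
  proof -
    interpret algebra "space (PiM UNIV M)" I.PF.generator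
      by (rule I.PF.algebra_generator)
    show "Int_stable I.PF.generator" "I.PF.generator \<subseteq> Pow (space (PiM UNIV M))"
      using space_closed by (auto simp: Int_stable_def)
  qed
  show ?thesis
  proof (rule emeasure_mixture_sigma_sets[OF prob[OF IT(1)] prob[OF IT(2)] prob[OF IT(3)] pq G])
    fix X assume "X \<in> I.PF.generator"
    then obtain J Y where X: "X = prod_emb UNIV M J Y" and J: "finite J" "Y \<in> sets (PiM J M)"
      by (auto elim!: I.PF.generator.cases)
    \<comment> \<open>The measures \<open>C\<close> live on initial segments, so the base of the
      cylinder is first pulled back from \<open>J\<close> to \<open>{0..<n}\<close>.\<close>
    obtain n where n: "J \<subseteq> {0..<n}"
      using I.up_to[OF J(1)] by blast
    have "prod_emb {0..<n} M J Y \<in> sets (PiM {0..<n} M)"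
      using n J by (intro measurable_prod_emb)
    from emeasure_Ionescu_Tulcea_C_mixture[OF IT pq initial later this]
    show "emeasure I.PF.lim X = ennreal p * emeasure I1.PF.lim X + ennreal q * emeasure I2.PF.lim X"
      unfolding X I.lim[OF J] I1.lim[OF J] I2.lim[OF J]
        I.emeasure_CI[OF n J(2)] I1.emeasure_CI[OF n J(2)] I2.emeasure_CI[OF n J(2)] .
  qed (simp_all add: A I.PF.sets_PiM_generator[symmetric])
qed

section \<open>Measurability of path functionals and stopping times\<close>

lemma space_PiM_obs_space [simp]: "space (PiM UNIV (\<lambda>_. obs_space)) = UNIV"
  by (simp add: space_PiM obs_space_def space_pair_measure)

lemma latent_measurable [measurable]:
  "latent t \<in> PiM UNIV (\<lambda>_. obs_space) \<rightarrow>\<^sub>M count_space UNIV"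
  using measurable_component_singleton[of t UNIV "\<lambda>_. obs_space"]
  unfolding latent_def[abs_def] obs_space_def by measurable

lemma response_measurable [measurable]:
  "response t \<in> PiM UNIV (\<lambda>_. obs_space) \<rightarrow>\<^sub>M borel"
  using measurable_component_singleton[of t UNIV "\<lambda>_. obs_space"]
  unfolding response_def[abs_def] obs_space_def by measurable

text \<open>This form makes the false-alarm event measurable: a countable union of conditions on
  finitely many coordinates. The free bound \<open>k\<close> also covers
  \<open>n = \<infinity>\<close>, where both sides are false.\<close>

lemma less_change_point_iff: "n < change_point \<omega> \<longleftrightarrow> (\<exists>k. n \<le> enat k \<and> (\<forall>s\<le>k. \<not> latent s \<omega>))"
proof
  assume less: "n < change_point \<omega>"
  then obtain k where k: "n = enat k"
    by (cases n) auto
  have "\<not> latent s \<omega>" if "s \<le> k" for s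
  proof
    assume "latent s \<omega>"
    then have "change_point \<omega> \<le> enat s"
      unfolding change_point_def by (intro Inf_lower) auto
    with less k that show False
      by (metis enat_ord_simps(2) leD order_less_le_trans)
  qed
  with k show "\<exists>k. n \<le> enat k \<and> (\<forall>s\<le>k. \<not> latent s \<omega>)" by blast
next
  assume "\<exists>k. n \<le> enat k \<and> (\<forall>s\<le>k. \<not> latent s \<omega>)"
  then obtain k where k: "n \<le> enat k" "\<forall>s\<le>k. \<not> latent s \<omega>" by blast
  have "enat (Suc k) \<le> change_point \<omega>"
    unfolding change_point_def using k(2) by (intro Inf_greatest) (auto simp: not_le[symmetric] Suc_le_eq)
  with k(1) show "n < change_point \<omega>"
    by (metis enat_ord_simps(2) lessI order_le_less_trans order_less_le_trans)
qed

context markov_changepoint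
begin

lemma sets_observed_subset:
  fixes \<rho> :: "'y rule"
  assumes "\<rho> \<in> assignment_rules K"
  shows "sets (observed \<rho> t) \<subseteq> sets (PiM UNIV (\<lambda>_. obs_space))"
proof -
  have "treatment \<rho> s -` A \<in> sets (PiM UNIV (\<lambda>_. obs_space))" if "1 \<le> s" for s A
  proof -
    have "treatment \<rho> s \<in> PiM UNIV (\<lambda>_. obs_space) \<rightarrow>\<^sub>M count_space UNIV"
      using treatment_measurable[OF assms that, of UNIV]
      by (auto intro: measurable_compose)
    from measurable_sets[OF this, of A] show ?thesis by simp
  qed
  moreover have "response s -` B \<in> sets (PiM UNIV (\<lambda>_. obs_space))" if "B \<in> sets borel" for s and B :: "'y set"
    using measurable_sets[OF response_measurable that, of s] by simp
  ultimately show ?thesis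
    unfolding observed_def
    by (subst sets_measure_of) (auto intro!: sets.sigma_sets_subset[where M="PiM UNIV (\<lambda>_. obs_space)", simplified])
qed

text \<open>Since \<open>enat\<close> is countable, it suffices to treat the level sets of
  \<open>T\<close>.\<close>

lemma stopping_time_measurable:
  fixes \<rho> :: "'y rule"
  assumes "(\<rho>, T) \<in> policies K"
  shows "T \<in> PiM UNIV (\<lambda>_. obs_space) \<rightarrow>\<^sub>M count_space UNIV"
proof -
  have le: "{\<omega>. T \<omega> \<le> t} \<in> sets (PiM UNIV (\<lambda>_. obs_space))" for t
  proof -
    have "{\<omega> \<in> space (observed \<rho> t). T \<omega> \<le> t} \<in> sets (observed \<rho> t)"
      using assms by (auto simp: policies_def stopping_time_def pred_def)
    moreover have "space (observed \<rho> t) = UNIV"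
      by (simp add: observed_def space_measure_of_conv)
    ultimately show ?thesis
      using sets_observed_subset assms by (auto simp: policies_def)
  qed
  have "T -` {t} \<in> sets (PiM UNIV (\<lambda>_. obs_space))" for t
  proof -
    \<comment> \<open>Only finite \<open>n\<close> below \<open>t\<close> are removed; for
      \<open>t = \<infinity>\<close> these sublevel sets exhaust the event that \<open>T\<close> is
      finite.\<close>
    have "T -` {t} = {\<omega>. T \<omega> \<le> t} - (\<Union>n\<in>{n. enat n < t}. {\<omega>. T \<omega> \<le> enat n})"
      by (auto simp: not_le) (metis enat_iless order.strict_iff_order not_infinity_eq order_le_less)
    with le show ?thesis
      by (auto intro!: sets.countable_UN')
  qed
  then show ?thesis
    by (simp add: measurable_count_space_eq_countable)
qed

section \<open>Dependence of the path law and the cost on the prior odds\<close>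

lemma path_kernel_initial:
  assumes "0 \<le> \<gamma>" and "A \<in> sets obs_space"
  shows "emeasure (path_kernel \<gamma> \<zeta> \<rho> 0 h) A
    = ennreal (\<gamma> / (1 + \<gamma>)) * indicator A (True, undefined)
      + ennreal (1 / (1 + \<gamma>)) * indicator A (False, undefined)"
proof -
  have "return obs_space (l, undefined :: 'y) \<in> space (subprob_algebra obs_space)" for l
    by (auto simp: space_subprob_algebra obs_space_def space_pair_measure
        intro!: prob_space_imp_subprob_space prob_space_return)
  then have "emeasure (path_kernel \<gamma> \<zeta> \<rho> 0 h) A
      = (\<integral>\<^sup>+ l. indicator A (l, undefined) \<partial>bernoulli_pmf (\<gamma> / (1 + \<gamma>)))"
    using assms(2) by (simp add: path_kernel_def emeasure_bind[where N=obs_space])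
  also have "\<dots> = ennreal (\<gamma> / (1 + \<gamma>)) * indicator A (True, undefined)
      + ennreal (1 - \<gamma> / (1 + \<gamma>)) * indicator A (False, undefined)"
    using assms(1) by (simp add: mult.commute)
  also have "1 - \<gamma> / (1 + \<gamma>) = 1 / (1 + \<gamma>)"
    using assms(1) by (simp add: field_simps)
  finally show ?thesis .
qed

text \<open>Since \<open>u + v = 1\<close>, \<open>1 + \<gamma>\<close> equals
  \<open>u * (1 + a) + v * (1 + b)\<close>. The weights are the shares of the two summands, so
  multiplying by \<open>1 + \<gamma>\<close> leaves the coefficients that concavity asks
  for.\<close>

lemma emeasure_path_law_mixture:
  fixes u v a b :: real
  defines "\<gamma> \<equiv> u * a + v * b"
  assumes \<rho>: "\<rho> \<in> assignment_rules K"
    and uv: "0 \<le> u" "0 \<le> v" "u + v = 1" and ab: "0 \<le> a" "0 \<le> b"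
    and A: "A \<in> sets (PiM UNIV (\<lambda>_. obs_space))"
  shows "emeasure (path_law \<gamma> \<zeta> \<rho>) A
    = ennreal (u * (1 + a) / (1 + \<gamma>)) * emeasure (path_law a \<zeta> \<rho>) A
      + ennreal (v * (1 + b) / (1 + \<gamma>)) * emeasure (path_law b \<zeta> \<rho>) A"
proof -
  have \<gamma>: "0 \<le> \<gamma>" "1 + \<gamma> = u * (1 + a) + v * (1 + b)"
    using uv ab by (auto simp: \<gamma>_def algebra_simps)
  let ?p = "u * (1 + a) / (1 + \<gamma>)" and ?q = "v * (1 + b) / (1 + \<gamma>)"
  show ?thesis
    unfolding path_law_def
  proof (rule emeasure_Ionescu_Tulcea_lim_mixture[OF Ionescu_Tulcea_path_kernel[OF \<rho>]
        Ionescu_Tulcea_path_kernel[OF \<rho>] Ionescu_Tulcea_path_kernel[OF \<rho>] _ _ _ _ _ _ A])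
    show "0 \<le> ?p" "0 \<le> ?q"
      using uv ab \<gamma>(1) by auto
    show "?p + ?q = 1"
      using \<gamma> by (simp flip: add_divide_distrib)
    fix A :: "(bool \<times> 'y) set" assume A: "A \<in> sets obs_space"
    \<comment> \<open>The factors \<open>1 + a\<close> and \<open>1 + b\<close> cancel. What remains
      is \<open>u * a + v * b = \<gamma>\<close> for the atom at \<open>True\<close> and
      \<open>u + v = 1\<close> for the atom at \<open>False\<close>.\<close>
    have True: "\<gamma> / (1 + \<gamma>) = ?p * (a / (1 + a)) + ?q * (b / (1 + b))"
      using ab \<gamma>(1) by (simp add: \<gamma>_def add_divide_distrib)
    have False: "1 / (1 + \<gamma>) = ?p * (1 / (1 + a)) + ?q * (1 / (1 + b))"
      using ab uv(3) by (simp flip: add_divide_distrib)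
    show "emeasure (path_kernel \<gamma> \<zeta> \<rho> 0 (\<lambda>_. undefined)) A
        = ennreal ?p * emeasure (path_kernel a \<zeta> \<rho> 0 (\<lambda>_. undefined)) A
          + ennreal ?q * emeasure (path_kernel b \<zeta> \<rho> 0 (\<lambda>_. undefined)) A"
      unfolding path_kernel_initial[OF \<gamma>(1) A] path_kernel_initial[OF ab(1) A]
        path_kernel_initial[OF ab(2) A] True False
      using \<gamma>(1) uv ab
      by (simp add: ennreal_mult' algebra_simps del: times_divide_eq_left times_divide_eq_right)
  \<comment> \<open>After time 0 the kernels do not involve the prior odds, which gives the
    remaining premises on later kernels.\<close>
  qed (simp_all add: path_kernel_def[abs_def])
qed

lemma sets_path_law:
  assumes "\<rho> \<in> assignment_rules K"
  shows "sets (path_law \<gamma> \<zeta> \<rho>) = sets (PiM UNIV (\<lambda>_. obs_space))"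
proof -
  interpret Ionescu_Tulcea "path_kernel \<gamma> \<zeta> \<rho>" "\<lambda>_. obs_space"
    by (rule Ionescu_Tulcea_path_kernel[OF assms])
  show ?thesis
    unfolding path_law_def by (rule PF.sets_lim)
qed

text \<open>The same policy is admissible for every prior, so with it held fixed both the expected
  delay and the false-alarm probability inherit the mixture of the path laws.\<close>

lemma cost_mixture:
  fixes u v a b :: real
  defines "\<gamma> \<equiv> u * a + v * b"
  assumes policy: "(\<rho>, T) \<in> policies K"
    and uv: "0 \<le> u" "0 \<le> v" "u + v = 1" and ab: "0 \<le> a" "0 \<le> b"
  shows "cost c \<gamma> \<zeta> \<rho> T = ennreal (u * (1 + a) / (1 + \<gamma>)) * cost c a \<zeta> \<rho> T
    + ennreal (v * (1 + b) / (1 + \<gamma>)) * cost c b \<zeta> \<rho> T"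
proof -
  have \<rho>: "\<rho> \<in> assignment_rules K"
    using policy by (simp add: policies_def)
  note T [measurable] = stopping_time_measurable[OF policy]
  note mix = emeasure_path_law_mixture[OF \<rho> uv ab, folded \<gamma>_def]
  have space: "space (path_law \<gamma>' \<zeta> \<rho>) = UNIV" for \<gamma>'
    using sets_eq_imp_space_eq[OF sets_path_law[OF \<rho>]] by simp
  have "{\<omega> \<in> space (PiM UNIV (\<lambda>_. obs_space)). T \<omega> < change_point \<omega>} \<in> sets (PiM UNIV (\<lambda>_. obs_space))"
    unfolding less_change_point_iff by measurable
  then have alarm: "{\<omega>. T \<omega> < change_point \<omega>} \<in> sets (PiM UNIV (\<lambda>_. obs_space))"
    by simp
  have "(\<lambda>\<omega>. ennreal_of_enat (T \<omega>)) \<in> borel_measurable (PiM UNIV (\<lambda>_. obs_space))"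
    by measurable
  then have "(\<lambda>\<omega>. ennreal_of_enat (T \<omega>)) \<in> borel_measurable (path_law \<gamma> \<zeta> \<rho>)"
    by (simp add: measurable_cong_sets[OF sets_path_law[OF \<rho>] refl])
  then have delay: "(\<integral>\<^sup>+ \<omega>. ennreal_of_enat (T \<omega>) \<partial>path_law \<gamma> \<zeta> \<rho>)
      = ennreal (u * (1 + a) / (1 + \<gamma>)) * (\<integral>\<^sup>+ \<omega>. ennreal_of_enat (T \<omega>) \<partial>path_law a \<zeta> \<rho>)
        + ennreal (v * (1 + b) / (1 + \<gamma>)) * (\<integral>\<^sup>+ \<omega>. ennreal_of_enat (T \<omega>) \<partial>path_law b \<zeta> \<rho>)"
    by (intro nn_integral_mixture mix) (simp_all add: sets_path_law[OF \<rho>])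
  show ?thesis
    unfolding cost_def space delay using mix[OF alarm] by (simp add: algebra_simps)
qed

section \<open>Concavity of the scaled optimal cost\<close>

text \<open>Stopping at time 0 under a constant rule costs only a false-alarm probability.
  Finiteness matters because \<open>enn2real\<close> would send an infinite infimum to 0.\<close>

lemma optimal_cost_finite: "(INF (\<rho>, T)\<in>policies K. cost c \<gamma> \<zeta> \<rho> T) < \<top>"
proof -
  let ?\<rho> = "(\<lambda>_ _. 1) :: 'y rule" and ?T = "\<lambda>_. 0"
  have \<rho>: "?\<rho> \<in> assignment_rules K"
    using K by (auto simp: assignment_rules_def)
  then have policy: "(?\<rho>, ?T) \<in> policies K"
    by (simp add: policies_def stopping_time_const)
  interpret prob_space "path_law \<gamma> \<zeta> ?\<rho>"
    unfolding path_law_def by (intro prob_space_Ionescu_Tulcea_lim Ionescu_Tulcea_path_kernel \<rho>)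
  have "cost c \<gamma> \<zeta> ?\<rho> ?T < \<top>"
    unfolding cost_def using emeasure_finite by (simp add: less_top)
  with INF_lower[OF policy, of "\<lambda>(\<rho>, T). cost c \<gamma> \<zeta> \<rho> T"] show ?thesis
    by (auto intro: le_less_trans)
qed

lemma concave_on_optimal_cost: "concave_on {0..} (\<lambda>\<gamma>. (1 + \<gamma>) * optimal_cost c \<gamma> \<zeta> \<delta>)"
proof (cases "\<delta> = 0")
  case True
  \<comment> \<open>The comparison is made in \<open>ennreal\<close>, where the infimum is taken,
    and transferred to the reals afterwards.\<close>
  define V where "V \<gamma> = (INF (\<rho>, T)\<in>policies K. cost c \<gamma> \<zeta> \<rho> T)" for \<gamma>
  have V: "V \<gamma> = ennreal (optimal_cost c \<gamma> \<zeta> \<delta>)" for \<gamma>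
    using True optimal_cost_finite by (simp add: optimal_cost_def V_def)
  have nonneg: "0 \<le> optimal_cost c \<gamma> \<zeta> \<delta>" for \<gamma>
    by (simp add: optimal_cost_def)
  show ?thesis
    unfolding concave_on_iff
  proof (intro conjI ballI allI impI)
    fix a b u v :: real
    assume "a \<in> {0..}" "b \<in> {0..}" and uv: "0 \<le> u" "0 \<le> v" "u + v = 1"
    then have ab: "0 \<le> a" "0 \<le> b" by auto
    define \<gamma> where "\<gamma> = u * a + v * b"
    have \<gamma>: "0 \<le> \<gamma>"
      using uv ab by (simp add: \<gamma>_def)
    \<comment> \<open>Each policy's costs at \<open>a\<close> and \<open>b\<close> are at least
      \<open>V a\<close> and \<open>V b\<close>, so the left side bounds its cost at \<gamma> from
      below and hence also the infimum.\<close>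
    have "ennreal (u * (1 + a) / (1 + \<gamma>)) * V a + ennreal (v * (1 + b) / (1 + \<gamma>)) * V b \<le> cost c \<gamma> \<zeta> \<rho> T"
      if policy: "(\<rho>, T) \<in> policies K" for \<rho> T
      unfolding cost_mixture[OF policy uv ab, folded \<gamma>_def] V_def
      using policy by (intro add_mono mult_left_mono INF_lower2[OF policy]) auto
    then have "ennreal (u * (1 + a) / (1 + \<gamma>)) * V a + ennreal (v * (1 + b) / (1 + \<gamma>)) * V b \<le> V \<gamma>"
      unfolding V_def[of \<gamma>] by (intro INF_greatest) auto
    then have "u * (1 + a) / (1 + \<gamma>) * optimal_cost c a \<zeta> \<delta> + v * (1 + b) / (1 + \<gamma>) * optimal_cost c b \<zeta> \<delta>
        \<le> optimal_cost c \<gamma> \<zeta> \<delta>"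
      using uv ab \<gamma> nonneg unfolding V
      by (simp add: ennreal_mult[symmetric] ennreal_plus[symmetric] del: ennreal_plus times_divide_eq_left)
    \<comment> \<open>Multiplying by the positive number \<open>1 + \<gamma>\<close> clears the
      denominators.\<close>
    then have "u * (1 + a) * optimal_cost c a \<zeta> \<delta> + v * (1 + b) * optimal_cost c b \<zeta> \<delta>
        \<le> (1 + \<gamma>) * optimal_cost c \<gamma> \<zeta> \<delta>"
      using \<gamma> by (simp add: pos_divide_le_eq mult.commute flip: add_divide_distrib)
    then show "u * ((1 + a) * optimal_cost c a \<zeta> \<delta>) + v * ((1 + b) * optimal_cost c b \<zeta> \<delta>)
        \<le> (1 + (u *\<^sub>R a + v *\<^sub>R b)) * optimal_cost c (u *\<^sub>R a + v *\<^sub>R b) \<zeta> \<delta>"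
      by (simp add: \<gamma>_def mult.assoc)
  qed simp
next
  case False
  then show ?thesis
    by (simp add: optimal_cost_def concave_on_iff)
qed

end

theorem lemmaB1:
  fixes K :: nat
    and \<mu> :: "'y::polish_space measure"
    and f g :: "nat \<Rightarrow> 'y \<Rightarrow> real"
    and \<kappa> :: nat
    and \<Psi> :: "nat \<Rightarrow> (nat \<Rightarrow> real) \<Rightarrow> real"
    and \<Phi> :: "nat \<Rightarrow> (nat \<Rightarrow> real) \<Rightarrow> (nat \<Rightarrow> real)"
    and c :: real and \<zeta> :: "nat \<Rightarrow> real" and \<delta> :: nat
  assumes "markov_changepoint K \<mu> f g \<kappa> \<Psi> \<Phi>"
    and "c > 0" and "\<zeta> \<in> Rn \<kappa>" and "\<delta> \<in> {0, 1}"
  shows "concave_on {0..}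
    (\<lambda>\<gamma>. (1 + \<gamma>) * markov_changepoint.optimal_cost K \<mu> f g \<Psi> \<Phi> c \<gamma> \<zeta> \<delta>)"
  using assms(1) by (rule markov_changepoint.concave_on_optimal_cost)

end
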